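(* Let $b\in M_n$. The Poisson equation $\Delta a=b$ is solvable for $a$ in $M_n/\mathbb{C}I$ (that is, there exists a class $a+\mathbb{C}I$, $a\in M_n$, with $\Delta a=b$) if and only if $\bar b=0$.
   Context: Let $x,y$ be $n\times n$ Hermitian matrices, and set $U=e^{2\pi i x/n}$, $V=e^{2\pi i y/n}$. It is assumed that $U,V$ generate the algebra $M_n$ of all $n\times n$ complex matrices, so that the commutant of $\{U,V\}$ is $\mathbb{C}I$, the scalar multiples of the identity matrix $I$. Let $\tau$ be the usual (unnormalized) trace on $M_n$, and equip $M_n$ with the Hilbert-Schmidt inner product $\langle a,b\rangle=\tau(a^*b)$, where $a^*$ is the conjugate transpose. Define the derivations $\delta_1=[y,\cdot]$ and $\delta_2=-[x,\cdot]$ on $M_n$, where $[a,b]=ab-ba$. The Laplacian is the nonnegative operator $\Delta=\delta_1^*\delta_1+\delta_2^*\delta_2$, where $\delta_\mu^*$ is the adjoint of $\delta_\mu$ with respect to $\langle\cdot,\cdot\rangle$; explicitly, $\Delta a=[y,[y,a]]+[x,[x,a]]$. Since $\Delta$ vanishes on $\mathbb{C}I$, $\Delta a$ depends only on the class of $a$ in $M_n/\mathbb{C}I$. For $a\in M_n$ write $\bar a=\frac{\tau(a)}{n}I$. *)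

theory Defs
  imports "HOL-Analysis.Analysis"
begin

text \<open>
  \<open>M\<^sub>n\<close> is the type \<^typ>\<open>complex^'n^'n\<close> with \<open>n = CARD('n)\<close>.  The product is \<open>**\<close> and the identity
  is \<open>mat 1\<close>; the pointwise class operation \<open>*\<close> on vectors is never used on matrices.
\<close>

definition cscale :: "complex \<Rightarrow> complex^'n^'n \<Rightarrow> complex^'n^'n" where
  "cscale c a = map_matrix ((*) c) a"

definition conj_transpose :: "complex^'n^'n \<Rightarrow> complex^'n^'n" where
  "conj_transpose a = map_matrix cnj (transpose a)"

definition hermitian :: "complex^'n^'n \<Rightarrow> bool" where
  "hermitian a \<longleftrightarrow> conj_transpose a = a"

text \<open>
  The library's \<^const>\<open>exp\<close> is not available on this type, which carries no (matrix) algebra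
  instance; the series below converges by \<open>mat_exp_summable\<close>.
\<close>

definition mat_power :: "complex^'n^'n \<Rightarrow> nat \<Rightarrow> complex^'n^'n" where
  "mat_power a k = (((**) a) ^^ k) (mat 1)"

definition mat_exp :: "complex^'n^'n \<Rightarrow> complex^'n^'n" where
  "mat_exp a = (\<Sum>k. mat_power a k /\<^sub>R fact k)"

definition subalgebra :: "(complex^'n^'n) set \<Rightarrow> bool" where
  "subalgebra S \<longleftrightarrow>
     mat 1 \<in> S \<and>
     (\<forall>a\<in>S. \<forall>b\<in>S. a + b \<in> S) \<and>
     (\<forall>c. \<forall>a\<in>S. cscale c a \<in> S) \<and>
     (\<forall>a\<in>S. \<forall>b\<in>S. a ** b \<in> S)"

definition generates_matrix_algebra :: "(complex^'n^'n) set \<Rightarrow> bool" where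
  "generates_matrix_algebra G \<longleftrightarrow> subalgebra hull G = UNIV"

definition hs_inner :: "complex^'n^'n \<Rightarrow> complex^'n^'n \<Rightarrow> complex" where
  "hs_inner a b = trace (conj_transpose a ** b)"

definition hs_adjoint ::
  "(complex^'n^'n \<Rightarrow> complex^'n^'n) \<Rightarrow> complex^'n^'n \<Rightarrow> complex^'n^'n" where
  "hs_adjoint f = (THE g. \<forall>a b. hs_inner (f a) b = hs_inner a (g b))"

definition commutator :: "complex^'n^'n \<Rightarrow> complex^'n^'n \<Rightarrow> complex^'n^'n" where
  "commutator a b = a ** b - b ** a"

definition delta1 :: "complex^'n^'n \<Rightarrow> complex^'n^'n \<Rightarrow> complex^'n^'n" where
  "delta1 y a = commutator y a"

definition delta2 :: "complex^'n^'n \<Rightarrow> complex^'n^'n \<Rightarrow> complex^'n^'n" where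
  "delta2 x a = - commutator x a"

definition laplacian ::
  "complex^'n^'n \<Rightarrow> complex^'n^'n \<Rightarrow> complex^'n^'n \<Rightarrow> complex^'n^'n" where
  "laplacian x y a =
     hs_adjoint (delta1 y) (delta1 y a) + hs_adjoint (delta2 x) (delta2 x a)"

definition mod_scalars :: "((complex^'n^'n) \<times> (complex^'n^'n)) set" where
  "mod_scalars = {(a, a'). a - a' \<in> range mat}"

text \<open>
  The map induced by the Laplacian on \<open>M\<^sub>n / \<complex>I = UNIV // mod_scalars\<close>, with values in \<open>M\<^sub>n\<close>;
  it is well defined by \<open>quotient_laplacian_class\<close>.
\<close>

definition quotient_laplacian ::
  "complex^'n^'n \<Rightarrow> complex^'n^'n \<Rightarrow> (complex^'n^'n) set \<Rightarrow> complex^'n^'n" where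
  "quotient_laplacian x y A = the_elem (laplacian x y ` A)"

definition matrix_mean :: "complex^'n^'n \<Rightarrow> complex^'n^'n" where
  "matrix_mean a = cscale (trace a / of_nat CARD('n)) (mat 1)"


lemma mat_exp_summable:
  fixes a :: "complex^'n^'n"
  shows "summable (\<lambda>k. mat_power a k /\<^sub>R fact k)"
proof -
  have "bilinear ((**) :: complex^'n^'n \<Rightarrow> complex^'n^'n \<Rightarrow> complex^'n^'n)"
    unfolding bilinear_def
  proof (intro allI conjI linearI)
    fix A B C :: "complex^'n^'n" and r :: real
    show "A ** (B + C) = A ** B + A ** C" by (rule matrix_add_ldistrib)
    show "(A + B) ** C = A ** C + B ** C"
      by (simp add: matrix_matrix_mult_def vec_eq_iff sum.distrib distrib_right)
    show "A ** (r *\<^sub>R B) = r *\<^sub>R (A ** B)"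
      by (simp add: matrix_scalar_ac scalar_matrix_assoc)
    show "(r *\<^sub>R A) ** B = r *\<^sub>R (A ** B)"
      by (simp add: scalar_matrix_assoc)
  qed
  then obtain K where K: "K > 0"
    "\<And>(A :: complex^'n^'n) (B :: complex^'n^'n). norm (A ** B) \<le> K * norm A * norm B"
    using bilinear_bounded_pos by blast
  have pow: "norm (mat_power a k) \<le> norm (mat 1 :: complex^'n^'n) * (K * norm a) ^ k" for k
  proof (induction k)
    case (Suc k)
    have "norm (mat_power a (Suc k)) \<le> (K * norm a) * norm (mat_power a k)"
      using K(2)[of a "mat_power a k"] by (simp add: mat_power_def)
    also have "\<dots> \<le> (K * norm a) * (norm (mat 1 :: complex^'n^'n) * (K * norm a) ^ k)"
      using Suc K(1) by (intro mult_left_mono) auto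
    finally show ?case by (simp add: algebra_simps)
  qed (simp add: mat_power_def)
  have "summable (\<lambda>k. norm (mat 1 :: complex^'n^'n) * (inverse (fact k) * (K * norm a) ^ k))"
    using summable_exp by (rule summable_mult)
  then show ?thesis
  proof (rule summable_comparison_test'[where N = 0])
    fix k :: nat
    show "norm (mat_power a k /\<^sub>R fact k)
        \<le> norm (mat 1 :: complex^'n^'n) * (inverse (fact k) * (K * norm a) ^ k)"
      using mult_left_mono[OF pow[of k], of "inverse (fact k)"] by (simp add: algebra_simps)
  qed
qed

lemma hs_inner_alt: "hs_inner a b = (\<Sum>i\<in>UNIV. \<Sum>j\<in>UNIV. cnj (a $ j $ i) * b $ j $ i)"
  by (simp add: hs_inner_def trace_def conj_transpose_def matrix_matrix_mult_def transpose_def)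

lemma hs_inner_self_eq_0_iff: "hs_inner a a = 0 \<longleftrightarrow> a = 0"
proof
  assume "hs_inner a a = 0"
  then have "Re (hs_inner a a) = 0" by simp
  moreover have "Re (hs_inner a a) = (\<Sum>i\<in>UNIV. \<Sum>j\<in>UNIV. (cmod (a $ j $ i))\<^sup>2)"
    by (simp add: hs_inner_alt cmod_power2 flip: power2_eq_square)
  ultimately have "\<forall>i j. (cmod (a $ j $ i))\<^sup>2 = 0"
    by (simp add: sum_nonneg_eq_0_iff sum_nonneg)
  then show "a = 0" by (simp add: vec_eq_iff)
qed (simp add: hs_inner_alt)

lemma hs_inner_diff_right: "hs_inner a (b - c) = hs_inner a b - hs_inner a c"
  by (simp add: hs_inner_alt algebra_simps sum_subtractf)

lemma hs_inner_diff_left: "hs_inner (b - c) a = hs_inner b a - hs_inner c a"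
  by (simp add: hs_inner_alt algebra_simps sum_subtractf)

lemma hs_adjoint_eqI:
  assumes "\<And>a b. hs_inner (f a) b = hs_inner a (g b)"
  shows "hs_adjoint f = g"
  unfolding hs_adjoint_def
proof (rule the_equality)
  fix h assume h: "\<forall>a b. hs_inner (f a) b = hs_inner a (h b)"
  have "hs_inner (h b - g b) (h b - g b) = 0" for b
    using h assms by (metis hs_inner_diff_right right_minus_eq)
  then show "h = g" by (simp add: hs_inner_self_eq_0_iff fun_eq_iff)
qed (use assms in blast)

lemma conj_transpose_mult: "conj_transpose (a ** b) = conj_transpose b ** conj_transpose a"
  by (simp add: conj_transpose_def matrix_matrix_mult_def transpose_def vec_eq_iff mult.commute)

lemma hs_inner_commutator:
  assumes "hermitian h"
  shows "hs_inner (commutator h a) b = hs_inner a (commutator h b)"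
proof -
  have "hs_inner (h ** a) b = hs_inner a (h ** b)"
    using assms by (simp add: hs_inner_def conj_transpose_mult hermitian_def matrix_mul_assoc)
  moreover have "hs_inner (a ** h) b = hs_inner a (b ** h)"
    using assms trace_mul_sym[of h "conj_transpose a ** b"]
    by (simp add: hs_inner_def conj_transpose_mult hermitian_def matrix_mul_assoc)
  ultimately show ?thesis
    by (simp add: commutator_def hs_inner_diff_left hs_inner_diff_right)
qed

lemma laplacian_explicit:
  assumes "hermitian x" "hermitian y"
  shows "laplacian x y a = commutator y (commutator y a) + commutator x (commutator x a)"
proof -
  have "hs_adjoint (delta1 y) = delta1 y"
    by (rule hs_adjoint_eqI) (simp add: delta1_def hs_inner_commutator assms)
  moreover have "hs_adjoint (delta2 x) = delta2 x"
  proof (rule hs_adjoint_eqI)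
    fix a b
    have "hs_inner (- c) d = - hs_inner c d" "hs_inner c (- d) = - hs_inner c d"
      for c d :: "complex^'a^'a"
      using hs_inner_diff_left[of 0 c d] hs_inner_diff_right[of c 0 d]
      by (simp_all add: hs_inner_alt)
    then show "hs_inner (delta2 x a) b = hs_inner a (delta2 x b)"
      by (simp add: delta2_def hs_inner_commutator assms)
  qed
  moreover have "commutator x (- c) = - commutator x c" for c
    by (simp add: commutator_def matrix_matrix_mult_def vec_eq_iff sum_negf)
  ultimately show ?thesis
    by (simp add: laplacian_def delta1_def delta2_def)
qed

lemma commutator_mat: "commutator h (mat c) = 0"
proof -
  have "(\<Sum>k\<in>UNIV. h $ i $ k * (if k = j then c else 0)) = h $ i $ j * c" for i j
    by (subst sum.remove[of _ j]) auto
  moreover have "(\<Sum>k\<in>UNIV. (if i = k then c else 0) * h $ k $ j) = c * h $ i $ j" for i j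
    by (subst sum.remove[of _ i]) auto
  ultimately show ?thesis
    by (simp add: commutator_def matrix_matrix_mult_def mat_def vec_eq_iff)
qed

lemma equiv_mod_scalars: "equiv UNIV (mod_scalars :: ((complex^'n^'n) \<times> _) set)"
proof (rule equivI)
  show "refl (mod_scalars :: ((complex^'n^'n) \<times> _) set)"
    by (auto simp: refl_on_def mod_scalars_def intro: image_eqI[where x = 0])
  show "sym (mod_scalars :: ((complex^'n^'n) \<times> _) set)"
  proof (rule symI)
    fix a b :: "complex^'n^'n" assume "(a, b) \<in> mod_scalars"
    then obtain c where "a - b = mat c" by (auto simp: mod_scalars_def)
    then have "b - a = - mat c" by (metis minus_diff_eq)
    also have "\<dots> = mat (- c)" by (simp add: mat_def vec_eq_iff)
    finally have "b - a = mat (- c)" .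
    then show "(b, a) \<in> mod_scalars" by (auto simp: mod_scalars_def)
  qed
  show "trans (mod_scalars :: ((complex^'n^'n) \<times> _) set)"
  proof (rule transI)
    fix a b d :: "complex^'n^'n" assume "(a, b) \<in> mod_scalars" "(b, d) \<in> mod_scalars"
    then obtain c c' where "a - b = mat c" "b - d = mat c'" by (auto simp: mod_scalars_def)
    then have "a - d = mat c + mat c'" by (metis diff_add_cancel add_diff_eq)
    also have "\<dots> = mat (c + c')" by (simp add: mat_def vec_eq_iff)
    finally show "(a, d) \<in> mod_scalars" by (auto simp: mod_scalars_def)
  qed
qed simp

lemma quotient_laplacian_class:
  "quotient_laplacian x y (mod_scalars `` {a}) = laplacian x y a"
proof -
  have "laplacian x y a' = laplacian x y a" if "(a, a') \<in> mod_scalars" for a'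
  proof -
    from that obtain c where c: "a - a' = mat c" by (auto simp: mod_scalars_def)
    have "commutator h a - commutator h a' = commutator h (a - a')" for h
      by (simp add: commutator_def matrix_matrix_mult_def vec_eq_iff sum_subtractf
          left_diff_distrib right_diff_distrib)
    then have "commutator h a = commutator h a'" for h
      by (simp add: c commutator_mat)
    then show ?thesis by (simp add: laplacian_def delta1_def delta2_def)
  qed
  moreover have "(a, a) \<in> mod_scalars"
    using equiv_class_self[OF equiv_mod_scalars, of a] by simp
  ultimately have "laplacian x y ` (mod_scalars `` {a}) = {laplacian x y a}" by blast
  then show ?thesis by (simp add: quotient_laplacian_def)
qed

end

theory Submission
  imports Defs
begin

text \<open>
  The Laplacian is self-adjoint for the real inner product \<open>Re \<langle>a, b\<rangle>\<close>, so its range is the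
  orthogonal complement of its kernel.  If \<open>\<Delta> a = 0\<close> then
  \<open>0 = \<langle>a, \<Delta> a\<rangle> = \<parallel>[y, a]\<parallel>\<^sup>2 + \<parallel>[x, a]\<parallel>\<^sup>2\<close>, so \<open>a\<close> commutes with \<open>x\<close> and \<open>y\<close>, hence with their
  exponentials and with all of \<open>M\<^sub>n\<close>.  The kernel therefore consists of the scalar matrices.
  Everything in the range has trace zero, and the component of a trace-zero \<open>b\<close> orthogonal to the
  range lies in the kernel, so it is a scalar matrix of trace zero and vanishes.
\<close>

lemma linear_commutator: "linear (commutator (h :: complex^'n^'n))"
  by (rule linearI)
    (simp_all add: commutator_def matrix_matrix_mult_def vec_eq_iff sum.distrib
      algebra_simps scaleR_sum_right sum_subtractf)

lemma commutator_eq_0_iff: "commutator a b = 0 \<longleftrightarrow> a ** b = b ** a"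
  by (simp add: commutator_def)

lemma commutator_eq_0_sym: "commutator a b = 0 \<longleftrightarrow> commutator b a = 0"
  by (auto simp: commutator_eq_0_iff)

lemma commutator_add_right: "commutator a (b + c) = commutator a b + commutator a c"
  by (rule linear_add[OF linear_commutator])

text \<open>\<open>linear\<close> only gives real homogeneity; complex scalars are needed for the
  generators and for \<open>subalgebra\<close>.\<close>

lemma commutator_cscale_right: "commutator a (cscale c b) = cscale c (commutator a b)"
  by (simp add: commutator_def cscale_def matrix_matrix_mult_def vec_eq_iff
      sum_distrib_left algebra_simps)

lemma commutator_mult_right_eq_0:
  assumes "commutator a b = 0" and "commutator a c = 0"
  shows "commutator a (b ** c) = 0"
  using assms unfolding commutator_eq_0_iff by (metis matrix_mul_assoc)

lemma trace_commutator: "trace (commutator a b) = 0"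
  using trace_mul_sym[of a b] by (simp add: commutator_def trace_sub)

lemma commutator_mat_power:
  assumes "commutator a b = 0"
  shows "commutator a (mat_power b k) = 0"
proof (induction k)
  case 0
  then show ?case by (simp add: mat_power_def commutator_mat)
next
  case (Suc k)
  then show ?case
    using commutator_mult_right_eq_0[OF assms] by (simp add: mat_power_def)
qed

lemma commutator_mat_exp:
  fixes a b :: "complex^'n^'n"
  assumes "commutator a b = 0"
  shows "commutator a (mat_exp b) = 0"
proof -
  have bl: "bounded_linear (commutator a)"
    using linear_commutator by (simp add: linear_conv_bounded_linear)
  \<comment> \<open>Linear maps in finite dimension are bounded, so the commutator passes through
    the convergent series term by term.\<close>
  have "commutator a (mat_exp b) = (\<Sum>k. commutator a (mat_power b k /\<^sub>R fact k))"
    unfolding mat_exp_def by (rule bounded_linear.suminf[OF bl mat_exp_summable])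
  also have "\<dots> = 0"
    by (simp add: linear_cmul[OF linear_commutator] commutator_mat_power[OF assms])
  finally show ?thesis .
qed

lemma subalgebra_commutant: "subalgebra {b. commutator a b = 0}"
  by (auto simp: subalgebra_def commutator_mat commutator_add_right commutator_cscale_right
      commutator_mult_right_eq_0) (simp add: cscale_def vec_eq_iff)

text \<open>The commutant of \<open>a\<close> is a subalgebra containing \<open>G\<close>, so by
  minimality it contains the hull.\<close>

lemma commutator_generators_eq_0:
  assumes "generates_matrix_algebra G" and "\<And>g. g \<in> G \<Longrightarrow> commutator a g = 0"
  shows "commutator a b = 0"
proof -
  have "subalgebra hull G \<subseteq> {b. commutator a b = 0}"
    by (rule hull_minimal) (use assms(2) subalgebra_commutant in auto)
  then show ?thesis
    using assms(1) by (auto simp: generates_matrix_algebra_def)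
qed

lemma central_matrix_scalar:
  fixes a :: "complex^'n^'n"
  assumes "\<And>b. commutator a b = 0"
  obtains c where "a = mat c"
proof -
  fix l :: 'n
  have "a $ i $ k = (if i = k then a $ l $ l else 0)" for i k
  proof -
    \<comment> \<open>The matrix unit with its only nonzero entry at \<open>(k, l)\<close>: the
      \<open>(i, l)\<close> entry of \<open>a ** ?E\<close> picks out \<open>a $ i $ k\<close>, that
      of \<open>?E ** a\<close> is \<open>a $ l $ l\<close> or 0.\<close>
    let ?E = "(\<chi> r s. if r = k then if s = l then 1 else 0 else 0) :: complex^'n^'n"
    have "(a ** ?E) $ i $ l = (?E ** a) $ i $ l"
      using assms[of ?E] by (simp add: commutator_eq_0_iff)
    moreover have "(a ** ?E) $ i $ l = a $ i $ k"
      by (simp add: matrix_matrix_mult_def if_distrib[of "(*) _"] cong: if_cong)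
    moreover have "(?E ** a) $ i $ l = (if i = k then a $ l $ l else 0)"
      by (simp add: matrix_matrix_mult_def if_distrib[of "\<lambda>z. z * _"] cong: if_cong)
    ultimately show ?thesis by simp
  qed
  then have "a = mat (a $ l $ l)"
    unfolding mat_def vec_eq_iff vec_lambda_beta by blast
  then show ?thesis by (rule that)
qed

lemma trace_mat: "trace (mat c :: complex^'n^'n) = of_nat CARD('n) * c"
  by (simp add: trace_def mat_def)

lemma matrix_mean_eq_0_iff:
  fixes b :: "complex^'n^'n"
  shows "matrix_mean b = 0 \<longleftrightarrow> trace b = 0"
  by (auto simp: matrix_mean_def cscale_def mat_def vec_eq_iff)

text \<open>Links Hilbert-Schmidt adjointness to the Euclidean structure in which the orthogonal
  decomposition is taken.\<close>

lemma inner_eq_Re_hs_inner: "a \<bullet> b = Re (hs_inner a b)"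
  unfolding hs_inner_alt inner_vec_def
  by (subst sum.swap) (simp add: inner_complex_def)

lemma inner_commutator:
  assumes "hermitian h"
  shows "commutator h a \<bullet> b = a \<bullet> commutator h b"
  by (simp add: inner_eq_Re_hs_inner hs_inner_commutator[OF assms])

lemma linear_laplacian:
  fixes x y :: "complex^'n^'n"
  assumes "hermitian x" and "hermitian y"
  shows "linear (laplacian x y)"
  unfolding laplacian_explicit[OF assms, abs_def]
  by (intro linear_compose_add linear_compose[OF linear_commutator linear_commutator, unfolded o_def])

lemma inner_laplacian:
  assumes "hermitian x" and "hermitian y"
  shows "laplacian x y a \<bullet> b = a \<bullet> laplacian x y b"
  by (simp add: laplacian_explicit[OF assms] inner_add_left inner_add_right
      inner_commutator[OF assms(1)] inner_commutator[OF assms(2)])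

lemma laplacian_eq_0_commutator:
  assumes "hermitian x" and "hermitian y" and "laplacian x y a = 0"
  shows "commutator a x = 0" and "commutator a y = 0"
proof -
  have "a \<bullet> laplacian x y a = commutator y a \<bullet> commutator y a + commutator x a \<bullet> commutator x a"
    by (simp add: laplacian_explicit[OF assms(1,2)] inner_add_right
        inner_commutator[OF assms(1)] inner_commutator[OF assms(2)])
  then have "commutator y a = 0 \<and> commutator x a = 0"
    using assms(3) by (simp add: add_nonneg_eq_0_iff)
  then show "commutator a x = 0" and "commutator a y = 0"
    by (simp_all add: commutator_eq_0_sym[of a])
qed

lemma trace_laplacian:
  assumes "hermitian x" and "hermitian y"
  shows "trace (laplacian x y a) = 0"
  by (simp add: laplacian_explicit[OF assms] trace_add trace_commutator)

theorem theorem3p1: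
  fixes x y b :: "complex^'n^'n"
  assumes "hermitian x" and "hermitian y"
    and "generates_matrix_algebra
           {mat_exp (cscale (2 * of_real pi * \<i> / of_nat CARD('n)) x),
            mat_exp (cscale (2 * of_real pi * \<i> / of_nat CARD('n)) y)}"
  shows "(\<exists>A \<in> UNIV // mod_scalars. quotient_laplacian x y A = b) \<longleftrightarrow> matrix_mean b = 0"
proof -
  let ?L = "laplacian x y"
  have kernel: "\<exists>c. t = mat c" if "?L t = 0" for t
  proof -
    have cscale_0: "cscale c 0 = (0 :: complex^'n^'n)" for c
      by (simp add: cscale_def vec_eq_iff)
    \<comment> \<open>Leaving \<open>c\<close> arbitrary covers the factor
      \<open>2 * of_real pi * \<i> / of_nat CARD('n)\<close> in both generators.\<close>
    have "commutator t (mat_exp (cscale c x)) = 0" "commutator t (mat_exp (cscale c y)) = 0" for c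
      using laplacian_eq_0_commutator[OF assms(1,2) that]
      by (auto intro!: commutator_mat_exp simp: commutator_cscale_right cscale_0)
    then have "commutator t d = 0" for d
      using commutator_generators_eq_0[OF assms(3)] by blast
    then show ?thesis by (metis central_matrix_scalar)
  qed
  have range: "b \<in> range ?L" if "trace b = 0"
  proof -
    have span: "span (range ?L) = range ?L"
      by (simp add: span_eq_iff linear_subspace_image linear_laplacian assms)
    obtain s t where s: "s \<in> range ?L" and t: "\<And>w. w \<in> range ?L \<Longrightarrow> orthogonal t w"
      and b: "b = s + t"
      using orthogonal_subspace_decomp_exists[of "range ?L" b] unfolding span by metis
    \<comment> \<open>Self-adjointness moves one \<open>?L\<close> across; \<open>t\<close> is
      orthogonal to \<open>?L (?L t)\<close>, so \<open>?L t\<close> has norm zero.\<close>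
    have "?L t \<bullet> ?L t = t \<bullet> ?L (?L t)"
      by (rule inner_laplacian[OF assms(1,2)])
    also have "\<dots> = 0"
      using t[of "?L (?L t)"] by (simp add: orthogonal_def)
    finally obtain c where c: "t = mat c"
      using kernel[of t] by auto
    have "trace t = 0"
      using that s by (auto simp: b trace_add trace_laplacian assms(1,2))
    then have "c = 0"
      by (simp add: c trace_mat)
    then have "t = 0"
      by (simp add: c mat_def vec_eq_iff)
    then show ?thesis using s b by simp
  qed
  \<comment> \<open>Every class has a representative, on which the induced map takes the value of
    \<open>?L\<close>.\<close>
  have "(\<exists>A \<in> UNIV // mod_scalars. quotient_laplacian x y A = b) \<longleftrightarrow> b \<in> range ?L"
    by (auto simp: quotient_def quotient_laplacian_class)
  also have "\<dots> \<longleftrightarrow> trace b = 0"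
    using range trace_laplacian[OF assms(1,2)] by auto
  finally show ?thesis by (simp add: matrix_mean_eq_0_iff)
qed

end
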